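(* Let $K$ be an $(\mathrm{I},\mathcal{R},\mathbf{r})$ Cantor set, where $\mathcal{R}=(R_n)_{n\ge0}$ and $\mathbf{r}=(r_{m,n})_{0\le m\le n}$. Define $t_0:=R_0-r_{0,0}$ and, recursively for $n\ge1$, $$t_n:=R_n-r_{n,n}-\sum_{k=1}^n\frac{r_{n-k,n}}{\prod_{i=1}^k t_{n-i}}.$$ If $t_n>0$ for all $n\ge0$, then $K\neq\emptyset$.
   Context: Definition of an $(\mathrm{I},\mathcal{R},\mathbf{r})$ Cantor set. Let $\mathrm{I}\subset\mathbb{R}$ be a closed interval, $\mathcal{R}=(R_n)_{n\ge0}$ a sequence of natural numbers, and $\mathbf{r}=(r_{m,n})$, $0\le m\le n$ integers, non-negative reals. Put $\mathcal{J}_0:=\{\mathrm{I}\}$. Given a collection $\mathcal{J}_n$ of closed intervals ($n\ge0$), construct $\mathcal{J}_{n+1}$ as follows. Splitting: subdivide each $J\in\mathcal{J}_n$ into $R_n$ closed subintervals of equal length; call the collection of all these $\mathcal{I}_{n+1}$. Removing: first, for each $J\in\mathcal{J}_n$ remove at most $r_{n,n}$ intervals of the current collection lying in $J$; then successively for $k=1,\dots,n$, for each $J\in\mathcal{J}_{n-k}$ remove at most $r_{n-k,n}$ intervals of the current (already reduced) collection lying in $J$ (the number removed may vary between intervals and which intervals are removed is arbitrary). The remaining collection is $\mathcal{J}_{n+1}$. Then $\bigcap_{n\ge1}\bigcup_{J\in\mathcal{J}_n}J$ is called an $(\mathrm{I},\mathcal{R},\mathbf{r})$ Cantor set; any set obtained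 by some admissible choice of removals is such a set. *)

theory Defs
  imports Complex_Main
begin

text \<open>
  The splitting step. Every bounded closed interval in \<open>\<J>\<close> is cut into \<open>N\<close> closed subintervals of
  equal length; neighbouring pieces share an endpoint.
\<close>

definition split_intervals :: "nat \<Rightarrow> real set set \<Rightarrow> real set set" where
  "split_intervals N \<J> =
     {{a + real i * ((b - a) / real N) .. a + real (Suc i) * ((b - a) / real N)} | a b i.
        a \<le> b \<and> {a..b} \<in> \<J> \<and> i < N}"

text \<open>
  One removing step: \<open>\<B>\<close> arises from the current collection \<open>\<A>\<close> by removing, for each \<open>J \<in> \<J>\<close>, a
  collection \<open>D J\<close> of at most \<open>c\<close> members of \<open>\<A>\<close> that lie in \<open>J\<close>.
  Distinct intervals of one level of the construction have disjoint interiors, so no member of \<open>\<A>\<close>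
  lies in two of them and the order in which the \<open>J \<in> \<J>\<close> are treated does not matter.
  Finiteness is required because \<^const>\<open>card\<close> is \<open>0\<close> on infinite sets.
\<close>

definition removal :: "real set set \<Rightarrow> real \<Rightarrow> real set set \<Rightarrow> real set set \<Rightarrow> bool" where
  "removal \<J> c \<A> \<B> \<longleftrightarrow>
     (\<exists>D. (\<forall>J\<in>\<J>. D J \<subseteq> {A\<in>\<A>. A \<subseteq> J} \<and> finite (D J) \<and> real (card (D J)) \<le> c) \<and>
          \<B> = \<A> - (\<Union>J\<in>\<J>. D J))"

text \<open>
  The collections \<open>\<J> 0, \<J> 1, \<dots>\<close> form an admissible run of the construction. In the step from
  \<open>\<J> n\<close> to \<open>\<J> (Suc n)\<close>, \<open>\<C> k\<close> is the current collection just before the removal indexed by the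
  intervals of \<open>\<J> (n - k)\<close>; thus \<open>\<C> 0\<close> is the split collection and \<open>\<C> (Suc n)\<close> is what is left at
  the end. The sequence \<open>\<C>\<close> is only constrained up to index \<open>Suc n\<close>.
\<close>

definition cantor_construction ::
    "real set \<Rightarrow> (nat \<Rightarrow> nat) \<Rightarrow> (nat \<Rightarrow> nat \<Rightarrow> real) \<Rightarrow> (nat \<Rightarrow> real set set) \<Rightarrow> bool" where
  "cantor_construction I R r \<J> \<longleftrightarrow>
     \<J> 0 = {I} \<and>
     (\<forall>n. \<exists>\<C>. \<C> 0 = split_intervals (R n) (\<J> n) \<and>
              (\<forall>k\<le>n. removal (\<J> (n - k)) (r (n - k) n) (\<C> k) (\<C> (Suc k))) \<and>
              \<J> (Suc n) = \<C> (Suc n))"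

text \<open>
  Meant for \<open>I = {a..b}\<close> with \<open>a < b\<close>: in a one-point interval the pieces of a splitting coincide.
\<close>

definition is_cantor_set ::
    "real set \<Rightarrow> (nat \<Rightarrow> nat) \<Rightarrow> (nat \<Rightarrow> nat \<Rightarrow> real) \<Rightarrow> real set \<Rightarrow> bool" where
  "is_cantor_set I R r K \<longleftrightarrow>
     (\<exists>\<J>. cantor_construction I R r \<J> \<and> K = (\<Inter>n\<in>{1..}. \<Union>(\<J> n)))"

function cantor_t :: "(nat \<Rightarrow> nat) \<Rightarrow> (nat \<Rightarrow> nat \<Rightarrow> real) \<Rightarrow> nat \<Rightarrow> real" where
  "cantor_t R r 0 = real (R 0) - r 0 0"
| "cantor_t R r (Suc n) =
     real (R (Suc n)) - r (Suc n) (Suc n)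
       - (\<Sum>k=1..Suc n. r (Suc n - k) (Suc n) / (\<Prod>i=1..k. cantor_t R r (Suc n - i)))"
  by pat_completeness auto
termination
  by (relation "measure (\<lambda>(R, r, n). n)") auto

end

theory Submission
  imports Defs "HOL-Analysis.Elementary_Normed_Spaces"
begin

text \<open>
  Counting gives \<open>card (\<J> (n + 1)) \<ge> R n * card (\<J> n) - (\<Sum>k\<le>n. r (n - k) n * card (\<J> (n - k)))\<close>.
  If \<open>card (\<J> (m + 1)) \<ge> t m * card (\<J> m)\<close> holds for all \<open>m < n\<close>, then \<open>card (\<J> (n - k))\<close> is at
  most \<open>card (\<J> n)\<close> divided by \<open>t (n - 1) \<cdots> t (n - k)\<close>, and the same inequality follows for \<open>m = n\<close>.
  Hence no \<open>\<J> n\<close> is empty, and the unions \<open>\<Union>(\<J> n)\<close> are nested nonempty compact sets.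
\<close>

text \<open>All intervals of one level have equal length and endpoints on one lattice. Encoding them
  by indices turns splitting, distinctness and counting into statements about natural
  numbers.\<close>

definition grid :: "real \<Rightarrow> real \<Rightarrow> nat \<Rightarrow> real set" where
  "grid c l i = {c + real i * l .. c + real (Suc i) * l}"

text \<open>For reading off endpoints from an equality of sets, since \<open>split_intervals\<close>
  names its intervals only by their endpoints. The assumptions keep both intervals nonempty; an
  empty interval does not determine its endpoints.\<close>

lemma grid_eq_Icc_iff:
  assumes "0 < l" "x \<le> y"
  shows "{x..y} = grid c l i \<longleftrightarrow> x = c + real i * l \<and> y = c + real (Suc i) * l"
  using assms by (auto simp: grid_def Icc_eq_Icc algebra_simps)

lemma grid_nonempty: "0 < l \<Longrightarrow> grid c l i \<noteq> {}"
  by (simp add: grid_def algebra_simps)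

lemma inj_grid: "0 < l \<Longrightarrow> inj (grid c l)"
  by (auto simp: inj_def grid_def Icc_eq_Icc algebra_simps mult_less_0_iff)

text \<open>Piece \<open>j\<close> of cell \<open>i\<close> starts at
  \<open>c + i * l + j * (l / N) = c + (i * N + j) * (l / N)\<close>, so it is the cell of index
  \<open>i * N + j\<close> in the grid refined \<open>N\<close> times.\<close>

lemma split_grid:
  assumes "0 < l" "0 < N"
  shows "split_intervals N (grid c l ` S) = grid c (l / real N) ` ((\<lambda>(i, j). i * N + j) ` (S \<times> {..<N}))"
    (is "?L = ?R")
proof -
  have piece: "{c + real i * l + real j * (l / real N) .. c + real i * l + real (Suc j) * (l / real N)}
      = grid c (l / real N) (i * N + j)" for i j
    using assms(2) by (simp add: grid_def field_simps)
  have len: "c + real (Suc i) * l - (c + real i * l) = l" for i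
    by (simp add: algebra_simps)
  show ?thesis
  proof (intro set_eqI iffI)
    fix X assume "X \<in> ?L"
    then obtain x y j where X: "X = {x + real j * ((y - x) / real N) .. x + real (Suc j) * ((y - x) / real N)}"
      and xy: "x \<le> y" "{x..y} \<in> grid c l ` S" and j: "j < N"
      unfolding split_intervals_def by blast
    from xy obtain i where i: "i \<in> S" "x = c + real i * l" "y = c + real (Suc i) * l"
      using grid_eq_Icc_iff[OF assms(1) xy(1)] by blast
    have "X = grid c (l / real N) (i * N + j)"
      unfolding X i(2,3) len piece ..
    moreover have "i * N + j \<in> (\<lambda>(i, j). i * N + j) ` (S \<times> {..<N})"
      using i(1) j by (intro image_eqI[of _ _ "(i, j)"]) simp_all
    ultimately show "X \<in> ?R" by (simp only: imageI)
  next
    fix X assume "X \<in> ?R"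
    then obtain i j where ij: "i \<in> S" "j < N" and X: "X = grid c (l / real N) (i * N + j)"
      by auto
    let ?x = "c + real i * l" and ?y = "c + real (Suc i) * l"
    have "X = {?x + real j * ((?y - ?x) / real N) .. ?x + real (Suc j) * ((?y - ?x) / real N)}"
      unfolding X len piece ..
    moreover have "?x \<le> ?y" using assms(1) by (simp add: algebra_simps)
    moreover have "{?x..?y} \<in> grid c l ` S" using ij(1) by (auto simp: grid_def)
    ultimately show "X \<in> ?L" using ij(2) unfolding split_intervals_def by blast
  qed
qed

lemma card_split_grid:
  assumes "0 < l" "0 < N"
  shows "card (split_intervals N (grid c l ` S)) = N * card (grid c l ` S)"
proof -
  have "inj_on (\<lambda>(i, j). i * N + j) (S \<times> {..<N})"
  proof (rule inj_onI)
    fix x y :: "nat \<times> nat"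
    assume x: "x \<in> S \<times> {..<N}" and y: "y \<in> S \<times> {..<N}"
      and eq: "(case x of (i, j) \<Rightarrow> i * N + j) = (case y of (i, j) \<Rightarrow> i * N + j)"
    obtain i j i' j' where xy: "x = (i, j)" "y = (i', j')" by fastforce
    \<comment> \<open>Division with remainder: \<open>j < N\<close> makes \<open>i\<close> the
      quotient of the index by \<open>N\<close>, and then \<open>j\<close> follows by
      cancellation.\<close>
    have "i = (i * N + j) div N" "(i' * N + j') div N = i'" using x y xy by simp_all
    then have "i = i'" using eq xy by simp
    then show "x = y" using eq xy by simp
  qed
  then have "card ((\<lambda>(i, j). i * N + j) ` (S \<times> {..<N})) = card S * N"
    by (simp add: card_image card_cartesian_product)
  moreover have "card (grid c m ` T) = card T" if "0 < m" for m T
    by (rule card_image[OF inj_on_subset[OF inj_grid[OF that] subset_UNIV]])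
  ultimately show ?thesis
    unfolding split_grid[OF assms(1,2)] using assms(1,2) by simp
qed

lemma split_intervals_refine:
  assumes "X \<in> split_intervals N \<J>"
  shows "\<exists>J\<in>\<J>. X \<subseteq> J"
proof -
  from assms obtain x y j where X: "X = {x + real j * ((y - x) / real N) .. x + real (Suc j) * ((y - x) / real N)}"
    and xy: "x \<le> y" "{x..y} \<in> \<J>" and j: "j < N"
    unfolding split_intervals_def by blast
  have "real (Suc j) * ((y - x) / real N) \<le> real N * ((y - x) / real N)"
    using j xy by (intro mult_right_mono) auto
  also have "\<dots> = y - x" using j by simp
  finally have "X \<subseteq> {x..y}" using xy unfolding X by auto
  then show ?thesis using xy(2) by blast
qed

text \<open>Subadditivity of \<open>card\<close> over the union of the \<open>D J\<close> bounds the
  loss, whether or not these collections overlap.\<close>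

lemma removal_card:
  assumes "removal \<J> c \<A> \<B>" "finite \<J>" "finite \<A>"
  shows "\<B> \<subseteq> \<A>" "real (card \<A>) - c * real (card \<J>) \<le> real (card \<B>)"
proof -
  from assms(1) obtain D where D: "\<And>J. J \<in> \<J> \<Longrightarrow> finite (D J) \<and> real (card (D J)) \<le> c"
    and B: "\<B> = \<A> - (\<Union>J\<in>\<J>. D J)"
    unfolding removal_def by blast
  show "\<B> \<subseteq> \<A>" using B by blast
  have "real (card (\<Union>J\<in>\<J>. D J)) \<le> (\<Sum>J\<in>\<J>. real (card (D J)))"
    using card_UN_le[OF assms(2), of D] by (metis of_nat_le_iff of_nat_sum)
  also have "\<dots> \<le> c * real (card \<J>)"
    using sum_bounded_above[of \<J> "\<lambda>J. real (card (D J))" c] D by (simp add: mult.commute)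
  finally have "real (card (\<Union>J\<in>\<J>. D J)) \<le> c * real (card \<J>)" .
  moreover have "card \<A> \<le> card \<B> + card (\<Union>J\<in>\<J>. D J)"
    unfolding B using diff_card_le_card_Diff[of "\<Union>J\<in>\<J>. D J" \<A>] assms(2) D by force
  ultimately show "real (card \<A>) - c * real (card \<J>) \<le> real (card \<B>)" by linarith
qed

text \<open>The losses of the \<open>Suc n\<close> successive removals add up. Finiteness is assumed
  here because \<open>cantor_construction_grid\<close>, which supplies it, uses this lemma inside
  its own induction.\<close>

lemma cantor_construction_step:
  assumes "cantor_construction I R r \<J>"
    and fin: "\<And>k. k \<le> n \<Longrightarrow> finite (\<J> k)"
    and fin_split: "finite (split_intervals (R n) (\<J> n))"
  shows "\<J> (Suc n) \<subseteq> split_intervals (R n) (\<J> n)"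
    and "real (card (split_intervals (R n) (\<J> n))) - (\<Sum>k\<le>n. r (n - k) n * real (card (\<J> (n - k))))
           \<le> real (card (\<J> (Suc n)))"
proof -
  obtain \<C> where C0: "\<C> 0 = split_intervals (R n) (\<J> n)"
    and C: "\<And>k. k \<le> n \<Longrightarrow> removal (\<J> (n - k)) (r (n - k) n) (\<C> k) (\<C> (Suc k))"
    and CS: "\<J> (Suc n) = \<C> (Suc n)"
    using assms(1) unfolding cantor_construction_def by metis
  have "\<C> k \<subseteq> \<C> 0 \<and> real (card (\<C> 0)) - (\<Sum>j<k. r (n - j) n * real (card (\<J> (n - j)))) \<le> real (card (\<C> k))"
    if "k \<le> Suc n" for k
    using that
  proof (induction k)
    case (Suc k)
    then have IH: "\<C> k \<subseteq> \<C> 0"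
      "real (card (\<C> 0)) - (\<Sum>j<k. r (n - j) n * real (card (\<J> (n - j)))) \<le> real (card (\<C> k))"
      by auto
    have "removal (\<J> (n - k)) (r (n - k) n) (\<C> k) (\<C> (Suc k))" using C Suc.prems by simp
    moreover have "finite (\<C> k)" using IH(1) C0 fin_split by (metis finite_subset)
    ultimately show ?case using removal_card[of "\<J> (n - k)" _ "\<C> k"] fin[of "n - k"] IH by fastforce
  qed simp
  from this[of "Suc n"] show "\<J> (Suc n) \<subseteq> split_intervals (R n) (\<J> n)"
    and "real (card (split_intervals (R n) (\<J> n))) - (\<Sum>k\<le>n. r (n - k) n * real (card (\<J> (n - k))))
           \<le> real (card (\<J> (Suc n)))"
    by (simp_all add: C0 CS lessThan_Suc_atMost)
qed

text \<open>Splitting refines the grid by the factor \<open>R n\<close>, and removing only shrinks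
  the index set. The induction is strong because one step removes relative to all earlier levels,
  whose finiteness must be known.\<close>

lemma cantor_construction_grid:
  assumes "cantor_construction {a..b} R r \<J>" "a < b" "\<And>n. 0 < R n"
  shows "\<exists>S. finite S \<and> \<J> n = grid a ((b - a) / (\<Prod>i<n. real (R i))) ` S"
proof (induction n rule: less_induct)
  case (less n)
  show ?case
  proof (cases n)
    case 0
    have "\<J> 0 = grid a (b - a) ` {0}"
      using assms(1) by (simp add: cantor_construction_def grid_def)
    then show ?thesis using 0 by (intro exI[of _ "{0}"]) simp
  next
    case (Suc m)
    let ?l = "(b - a) / (\<Prod>i<m. real (R i))"
    have l: "0 < ?l" using assms(2,3) by (simp add: prod_pos)
    obtain S where S: "finite S" "\<J> m = grid a ?l ` S" using less Suc by blast
    define T where "T = (\<lambda>(i, j). i * R m + j) ` (S \<times> {..<R m})"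
    have T: "finite T" "split_intervals (R m) (\<J> m) = grid a (?l / real (R m)) ` T"
      using S(1) split_grid[OF l assms(3)] unfolding S(2) T_def by simp_all
    have "finite (\<J> k)" if "k \<le> m" for k using less[of k] Suc that by auto
    then have "\<J> (Suc m) \<subseteq> grid a (?l / real (R m)) ` T"
      using cantor_construction_step(1)[OF assms(1), of m] T by simp
    then obtain U where "U \<subseteq> T" "\<J> (Suc m) = grid a (?l / real (R m)) ` U"
      by (meson subset_image_iff)
    then show ?thesis
      using Suc T(1) finite_subset by (intro exI[of _ U]) (auto simp: mult.commute)
  qed
qed

text \<open>The term \<open>r n n\<close> is the summand \<open>k = 0\<close>, whose product is
  empty. This form covers both defining equations and matches the sum in
  \<open>cantor_construction_step\<close>.\<close>

lemma cantor_t_eq: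
  "cantor_t R r n = real (R n) - (\<Sum>k\<le>n. r (n - k) n / (\<Prod>i=1..k. cantor_t R r (n - i)))"
proof (cases n)
  case (Suc m)
  have "(\<Sum>k\<le>Suc m. f k) = f 0 + (\<Sum>k=1..Suc m. f k)" for f :: "nat \<Rightarrow> real"
    unfolding atMost_atLeast0 by (subst sum.atLeast_Suc_atMost) simp_all
  then show ?thesis unfolding Suc by simp
qed simp

lemma card_growth:
  assumes "cantor_construction {a..b} R r \<J>" "a < b"
    and r: "\<And>m n. m \<le> n \<Longrightarrow> 0 \<le> r m n"
    and t: "\<And>n. 0 < cantor_t R r n"
    and R: "\<And>n. 0 < R n"
  shows "cantor_t R r n * real (card (\<J> n)) \<le> real (card (\<J> (Suc n)))"
proof (induction n rule: less_induct)
  case (less n)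
  let ?P = "\<lambda>k. \<Prod>i=1..k. cantor_t R r (n - i)"
  have P: "0 < ?P k" for k by (intro prod_pos) (simp add: t)
  \<comment> \<open>Chains the induction hypotheses for the levels \<open>n - 1\<close> down to
    \<open>n - k\<close>.\<close>
  have prod_card: "?P k * real (card (\<J> (n - k))) \<le> real (card (\<J> n))" if "k \<le> n" for k
    using that
  proof (induction k)
    case (Suc k)
    have "cantor_t R r (n - Suc k) * real (card (\<J> (n - Suc k))) \<le> real (card (\<J> (n - k)))"
      using less[of "n - Suc k"] Suc.prems by (simp add: Suc_diff_Suc)
    then have "?P k * (cantor_t R r (n - Suc k) * real (card (\<J> (n - Suc k)))) \<le> ?P k * real (card (\<J> (n - k)))"
      using P[of k] by (intro mult_left_mono) simp_all
    with Suc show ?case by (simp add: mult.assoc)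
  qed simp
  have fin: "finite (\<J> k)" for k using cantor_construction_grid[OF assms(1,2) R, of k] by auto
  let ?l = "(b - a) / (\<Prod>i<n. real (R i))"
  have l: "0 < ?l" using assms(2) R by (simp add: prod_pos)
  obtain S where S: "finite S" "\<J> n = grid a ?l ` S"
    using cantor_construction_grid[OF assms(1,2) R, of n] by blast
  have "finite (split_intervals (R n) (\<J> n))"
    unfolding S(2) split_grid[OF l R] using S(1) by simp
  note step = cantor_construction_step(2)[OF assms(1) fin this]
  have card: "card (split_intervals (R n) (\<J> n)) = R n * card (\<J> n)"
    unfolding S(2) by (rule card_split_grid[OF l R])
  have "(\<Sum>k\<le>n. r (n - k) n * real (card (\<J> (n - k)))) \<le> (\<Sum>k\<le>n. r (n - k) n / ?P k * real (card (\<J> n)))"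
  proof (rule sum_mono)
    fix k assume "k \<in> {..n}"
    then have "real (card (\<J> (n - k))) \<le> real (card (\<J> n)) / ?P k"
      using prod_card[of k] P[of k] by (simp add: field_simps)
    from mult_left_mono[OF this r[of "n - k" n]]
    show "r (n - k) n * real (card (\<J> (n - k))) \<le> r (n - k) n / ?P k * real (card (\<J> n))" by simp
  qed
  \<comment> \<open>Here the recursion for \<open>cantor_t\<close> enters: the coefficients of
    \<open>card (\<J> n)\<close> sum to exactly \<open>R n - t n\<close>.\<close>
  also have "\<dots> = (real (R n) - cantor_t R r n) * real (card (\<J> n))"
    by (subst cantor_t_eq) (simp add: sum_distrib_right)
  finally show ?case using step card by (simp add: algebra_simps)
qed

theorem theorem3:
  fixes a b :: real
    and R :: "nat \<Rightarrow> nat"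
    and r :: "nat \<Rightarrow> nat \<Rightarrow> real"
    and K :: "real set"
  assumes "a < b"
    and "\<And>m n. m \<le> n \<Longrightarrow> 0 \<le> r m n"
    and "is_cantor_set {a..b} R r K"
    and "\<And>n. 0 < cantor_t R r n"
  shows "K \<noteq> {}"
proof -
  obtain \<J> where J: "cantor_construction {a..b} R r \<J>" and K: "K = (\<Inter>n\<in>{1..}. \<Union>(\<J> n))"
    using assms(3) unfolding is_cantor_set_def by blast
  \<comment> \<open>\<open>R n\<close> is \<open>t n\<close> plus a sum of nonnegative
    terms.\<close>
  have R: "0 < R n" for n
  proof -
    have "0 \<le> (\<Sum>k\<le>n. r (n - k) n / (\<Prod>i=1..k. cantor_t R r (n - i)))"
      by (intro sum_nonneg divide_nonneg_nonneg prod_nonneg) (auto simp: assms(2) assms(4)[THEN less_imp_le])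
    then show ?thesis using assms(4)[of n] cantor_t_eq[of R r n] by simp
  qed
  let ?l = "\<lambda>n. (b - a) / (\<Prod>i<n. real (R i))"
  have l: "0 < ?l n" for n using assms(1) R by (simp add: prod_pos)
  have grid: "\<exists>S. finite S \<and> \<J> n = grid a (?l n) ` S" for n
    by (rule cantor_construction_grid[OF J assms(1) R])
  have fin: "finite (\<J> n)" for n using grid[of n] by auto
  have compact: "compact (\<Union>(\<J> n))" for n
    using grid[of n] by (intro compact_Union fin) (auto simp: grid_def)
  have card_pos: "0 < card (\<J> n)" for n
  proof (induction n)
    case 0
    then show ?case using J by (simp add: cantor_construction_def)
  next
    case (Suc n)
    then have "0 < cantor_t R r n * real (card (\<J> n))" using assms(4) by simp
    also note card_growth[OF J assms(1,2,4) R]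
    finally show ?case by simp
  qed
  have nonempty: "\<Union>(\<J> n) \<noteq> {}" for n
  proof -
    obtain S where S: "\<J> n = grid a (?l n) ` S" using grid[of n] by blast
    with card_pos[of n] obtain i where "i \<in> S" by fastforce
    \<comment> \<open>A nonempty collection could still have an empty union; the members are cells
      of positive length, which excludes this.\<close>
    then show ?thesis using grid_nonempty[OF l, of a n i] unfolding S by blast
  qed
  have nested: "\<Union>(\<J> (Suc n)) \<subseteq> \<Union>(\<J> n)" for n
  proof -
    obtain S where S: "finite S" "\<J> n = grid a (?l n) ` S" using grid[of n] by blast
    have "finite (split_intervals (R n) (\<J> n))"
      unfolding S(2) split_grid[OF l R] using S(1) by simp
    from cantor_construction_step(1)[OF J fin this] show ?thesis
      using split_intervals_refine by blast
  qed
  \<comment> \<open>Cantor's intersection theorem. The intersection includes level 0, so it is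
    contained in \<open>K\<close>.\<close>
  have "(\<Inter>n. \<Union>(\<J> n)) \<noteq> {}"
    by (rule compact_nest[OF compact nonempty]) (rule lift_Suc_antimono_le[of "\<lambda>n. \<Union>(\<J> n)", OF nested])
  then show ?thesis unfolding K by blast
qed

end
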